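(* Let $\{\chi = \omega\}$ denote the graph class $\{ H \mid \chi(H) = \omega(H) \}$. Then for all graphs $G$, $$c_{\{\chi = \omega\}}(G) = \left\lceil \frac{\log \chi(G)}{\log \omega(G)} \right\rceil.$$
   Context: $\chi$ denotes the chromatic number and $\omega$ the clique number. Logarithms are to base 2. For a class of graphs $\mathcal{P}$, a covering of a graph $G$ by graphs of class $\mathcal{P}$ is an expression $E(G) = E(G_1) \cup \dots \cup E(G_k)$ of the edge set of $G$ as the union of the edge sets of graphs $G_1, \dots, G_k$ with $G_i \in \mathcal{P}$ for all $i \in \{1, \dots, k\}$. The cover number $c_{\mathcal{P}}(G)$ is the smallest $k$ such that $G$ admits a covering by $k$ graphs of class $\mathcal{P}$. *)

theory Defs
  imports Complex_Main "HOL-Library.Ramsey"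
begin

text \<open>Finite simple graphs, as pairs of a vertex set and a set of two-element subsets of it.\<close>

type_synonym 'a graph = "'a set \<times> 'a set set"

abbreviation verts :: "'a graph \<Rightarrow> 'a set" where "verts \<equiv> fst"
abbreviation edges :: "'a graph \<Rightarrow> 'a set set" where "edges \<equiv> snd"

definition fin_graph :: "'a graph \<Rightarrow> bool" where
  "fin_graph G \<longleftrightarrow> finite (verts G) \<and> edges G \<subseteq> [verts G]\<^bsup>2\<^esup>"

definition proper_colouring :: "'a graph \<Rightarrow> nat \<Rightarrow> ('a \<Rightarrow> nat) \<Rightarrow> bool" where
  "proper_colouring G n c \<longleftrightarrow>
     c \<in> verts G \<rightarrow> {..<n} \<and>
     (\<forall>u\<in>verts G. \<forall>v\<in>verts G. {u, v} \<in> edges G \<longrightarrow> c u \<noteq> c v)"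

definition chromatic_number :: "'a graph \<Rightarrow> nat" where
  "chromatic_number G = (LEAST n. \<exists>c. proper_colouring G n c)"

definition clique_number :: "'a graph \<Rightarrow> nat" where
  "clique_number G = Max {card K | K. K \<subseteq> verts G \<and> clique K (edges G)}"

text \<open>The covering graphs may have any vertex sets. The empty covering \<open>k = 0\<close> is allowed;
  it covers exactly the edgeless graphs.\<close>

definition has_covering :: "'a graph set \<Rightarrow> 'a graph \<Rightarrow> nat \<Rightarrow> bool" where
  "has_covering P G k \<longleftrightarrow>
     (\<exists>H :: nat \<Rightarrow> 'a graph.
        (\<forall>i\<in>{1..k}. fin_graph (H i) \<and> H i \<in> P) \<and>
        edges G = (\<Union>i\<in>{1..k}. edges (H i)))"

definition cover_number :: "'a graph set \<Rightarrow> 'a graph \<Rightarrow> nat" where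
  "cover_number P G = (LEAST k. has_covering P G k)"

definition chi_eq_omega :: "'a graph set" where
  "chi_eq_omega = {H. fin_graph H \<and> chromatic_number H = clique_number H}"

end

theory Submission
  imports Defs
begin

text \<open>
  Write \<open>\<chi>\<close> and \<open>\<omega>\<close> for the chromatic and the clique number of \<open>G\<close>. For a graph with at least one
  edge, \<open>k\<close> graphs with equal chromatic and clique number cover \<open>G\<close> if and only if
  \<open>\<chi> \<le> \<omega> ^ k\<close> (\<open>has_covering_iff\<close>); the least such \<open>k\<close> is the rounded-up quotient of logarithms.

  If \<open>G\<close> is covered by \<open>H\<^sub>1, \<dots>, H\<^sub>k\<close>, then every clique of \<open>H\<^sub>i\<close> with at least two vertices is a clique
  of \<open>G\<close>, so \<open>H\<^sub>i\<close> has a colouring with \<open>\<omega>\<close> colours. The tuple of these \<open>k\<close> colours is a proper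
  colouring of \<open>G\<close> with \<open>\<omega> ^ k\<close> values (\<open>chromatic_number_le_power\<close>).

  Conversely, if \<open>\<chi> \<le> \<omega> ^ k\<close>, then \<open>G\<close> can be coloured properly by words of length \<open>k\<close> over \<open>\<omega>\<close>
  letters. The edges whose ends differ in the \<open>i\<close>-th letter form a graph \<open>H\<^sub>i\<close> that the \<open>i\<close>-th letter
  colours, and each edge of \<open>G\<close> lies in some \<open>H\<^sub>i\<close>. This gives only an upper bound on the chromatic
  number of \<open>H\<^sub>i\<close>; what forces \<open>H\<^sub>i\<close> into the class is a choice of names for the colours. The vertices
  of a maximum clique \<open>K\<close> of \<open>G\<close> have distinct colours, so these can be renamed to the
  \<open>\<omega>\<close> constant words (\<open>inj_on_extension\<close>). Then any two vertices of \<open>K\<close> differ in every letter, and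
  \<open>K\<close> is a clique of size \<open>\<omega>\<close> in every \<open>H\<^sub>i\<close>.

  For an edgeless graph the empty covering works, and the quotient is \<open>0\<close> because its
  denominator is \<open>log 2 1\<close> or \<open>log 2 0\<close>, both of which are \<open>0\<close>.
\<close>

section \<open>Colourings and cliques\<close>

lemma chromatic_number_le_iff:
  assumes "fin_graph G"
  shows "chromatic_number G \<le> n \<longleftrightarrow> (\<exists>c. proper_colouring G n c)"
proof
  have fin: "finite (verts G)" and E: "edges G \<subseteq> [verts G]\<^bsup>2\<^esup>"
    using assms by (auto simp: fin_graph_def)
  obtain h where h: "bij_betw h (verts G) {0..<card (verts G)}"
    using ex_bij_betw_finite_nat[OF fin] by blast
  have "proper_colouring G (card (verts G)) h"
    unfolding proper_colouring_def
  proof (intro conjI ballI impI)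
    show "h \<in> verts G \<rightarrow> {..<card (verts G)}"
      using h by (auto simp: bij_betw_def)
    fix u v assume uv: "u \<in> verts G" "v \<in> verts G" "{u, v} \<in> edges G"
    then have "u \<noteq> v" using E by (auto simp: nsets_def)
    then show "h u \<noteq> h v" using h uv by (auto simp: bij_betw_def inj_on_def)
  qed
  then have "\<exists>c. proper_colouring G (card (verts G)) c" by blast
  then have "\<exists>c. proper_colouring G (chromatic_number G) c"
    unfolding chromatic_number_def by (rule LeastI)
  then obtain c where "proper_colouring G (chromatic_number G) c" ..
  moreover assume "chromatic_number G \<le> n"
  ultimately have "proper_colouring G n c"
    by (auto simp: proper_colouring_def Pi_iff intro: less_le_trans)
  then show "\<exists>c. proper_colouring G n c" by blast
next
  show "\<exists>c. proper_colouring G n c \<Longrightarrow> chromatic_number G \<le> n"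
    unfolding chromatic_number_def by (rule Least_le)
qed

lemma finite_clique_cards:
  assumes "fin_graph G"
  shows "finite {card K | K. K \<subseteq> verts G \<and> clique K (edges G)}"
proof -
  have "finite (card ` Pow (verts G))" using assms by (simp add: fin_graph_def)
  then show ?thesis by (rule rev_finite_subset) auto
qed

lemma card_clique_le_clique_number:
  assumes "fin_graph G" "K \<subseteq> verts G" "clique K (edges G)"
  shows "card K \<le> clique_number G"
  unfolding clique_number_def
  by (rule Max_ge[OF finite_clique_cards]) (use assms in auto)

lemma maximum_clique_exists:
  assumes "fin_graph G"
  obtains K where "K \<subseteq> verts G" "clique K (edges G)" "card K = clique_number G"
proof -
  have "clique {} (edges G)" by (simp add: clique_def)
  then have "{card K | K. K \<subseteq> verts G \<and> clique K (edges G)} \<noteq> {}" by blast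
  from Max_in[OF finite_clique_cards[OF assms] this] show thesis
    using that unfolding clique_number_def by force
qed

lemma proper_colouring_inj_on_clique:
  assumes "proper_colouring G n c" "K \<subseteq> verts G" "clique K (edges G)"
  shows "inj_on c K"
  using assms unfolding proper_colouring_def clique_def inj_on_def by (meson subsetD)

lemma clique_number_le_chromatic_number:
  assumes "fin_graph G"
  shows "clique_number G \<le> chromatic_number G"
proof -
  obtain K where K: "K \<subseteq> verts G" "clique K (edges G)" "card K = clique_number G"
    using maximum_clique_exists[OF assms] .
  obtain c where c: "proper_colouring G (chromatic_number G) c"
    using chromatic_number_le_iff[OF assms] by blast
  have "c ` K \<subseteq> {..<chromatic_number G}"
    using c K(1) by (auto simp: proper_colouring_def)
  with proper_colouring_inj_on_clique[OF c K(1,2)] have "card K \<le> card {..<chromatic_number G}"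
    by (intro card_inj_on_le) auto
  then show ?thesis using K(3) by simp
qed

lemma clique_number_ge_2_iff:
  assumes "fin_graph G"
  shows "2 \<le> clique_number G \<longleftrightarrow> edges G \<noteq> {}"
proof
  assume 2: "2 \<le> clique_number G"
  obtain K where K: "clique K (edges G)" "card K = clique_number G"
    using maximum_clique_exists[OF assms] by metis
  then have "\<not> card K \<le> Suc 0" "finite K"
    using 2 by (auto intro: card_ge_0_finite)
  then obtain u v where "u \<in> K" "v \<in> K" "u \<noteq> v"
    using card_le_Suc0_iff_eq[of K] by blast
  then show "edges G \<noteq> {}" using K(1) by (auto simp: clique_def)
next
  assume "edges G \<noteq> {}"
  then obtain e where e: "e \<in> edges G" by blast
  then have "e \<subseteq> verts G" "card e = 2"
    using assms by (auto simp: fin_graph_def nsets_def)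
  then obtain u v where uv: "e = {u, v}" "u \<noteq> v" by (meson card_2_iff)
  have "clique e (edges G)" using e uv by (auto simp: clique_def insert_commute)
  from card_clique_le_clique_number[OF assms \<open>e \<subseteq> verts G\<close> this]
  show "2 \<le> clique_number G" using \<open>card e = 2\<close> by simp
qed

text \<open>
  The vertex sets need not be nested: a clique with two or more vertices lies inside the union of
  the edges, and one that is smaller is outweighed by any edge of \<open>G\<close>.
\<close>

lemma clique_number_mono_edges:
  assumes G: "fin_graph G" "edges G \<noteq> {}" and H: "fin_graph H" "edges H \<subseteq> edges G"
  shows "clique_number H \<le> clique_number G"
proof -
  obtain K where K: "clique K (edges H)" "card K = clique_number H"
    using maximum_clique_exists[OF H(1)] by metis
  show ?thesis
  proof (cases "2 \<le> card K")
    case False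
    then show ?thesis using K(2) clique_number_ge_2_iff[OF G(1)] G(2) by linarith
  next
    case True
    then have big: "\<not> card K \<le> Suc 0" and "finite K"
      by (auto intro: card_ge_0_finite)
    have "K \<subseteq> verts G"
    proof
      fix u assume u: "u \<in> K"
      obtain v where "v \<in> K" "v \<noteq> u"
        using u big card_le_Suc0_iff_eq[OF \<open>finite K\<close>] by metis
      then have "{u, v} \<in> edges G" using u K(1) H(2) by (auto simp: clique_def)
      then show "u \<in> verts G" using G(1) by (auto simp: fin_graph_def nsets_def)
    qed
    moreover have "clique K (edges G)" using K(1) H(2) by (auto simp: clique_def)
    ultimately show ?thesis using card_clique_le_clique_number[OF G(1)] K(2) by metis
  qed
qed

section \<open>Colouring by words\<close>

lemma chromatic_number_le_card:
  assumes G: "fin_graph G" and B: "finite B" "f ` verts G \<subseteq> B"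
    and ne: "\<And>u v. {u, v} \<in> edges G \<Longrightarrow> f u \<noteq> f v"
  shows "chromatic_number G \<le> card B"
proof -
  obtain h where h: "bij_betw h B {0..<card B}"
    using ex_bij_betw_finite_nat[OF B(1)] by blast
  have "proper_colouring G (card B) (h \<circ> f)"
    unfolding proper_colouring_def
  proof (intro conjI ballI impI)
    show "h \<circ> f \<in> verts G \<rightarrow> {..<card B}"
      using h B(2) by (fastforce simp: bij_betw_def)
    fix u v assume uv: "u \<in> verts G" "v \<in> verts G" "{u, v} \<in> edges G"
    then have "f u \<noteq> f v" "f u \<in> B" "f v \<in> B" using ne B(2) by auto
    then show "(h \<circ> f) u \<noteq> (h \<circ> f) v"
      using h by (auto simp: bij_betw_def inj_on_def)
  qed
  then show ?thesis using chromatic_number_le_iff[OF G] by blast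
qed

text \<open>
  The tuple of colours of a vertex in the \<open>k\<close> covering graphs separates the ends of an edge of \<open>G\<close>,
  since the graph that contains the edge already does.
\<close>

lemma chromatic_number_le_power:
  assumes G: "fin_graph G" and w: "0 < w"
    and H: "\<And>i. i \<in> {1..k} \<Longrightarrow> fin_graph (H i) \<and> chromatic_number (H i) \<le> w"
    and cover: "edges G = (\<Union>i\<in>{1..k}. edges (H i))"
  shows "chromatic_number G \<le> w ^ k"
proof -
  have "\<exists>c. proper_colouring (H i) w c" if "i \<in> {1..k}" for i
    using H[OF that] chromatic_number_le_iff by blast
  then obtain c where c: "\<And>i. i \<in> {1..k} \<Longrightarrow> proper_colouring (H i) w (c i)"
    by metis
  \<comment> \<open>A vertex outside \<open>H i\<close> has no edge there, so any letter will do for it; \<open>0\<close> is one.\<close>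
  define f where "f v = (\<lambda>i\<in>{1..k}. if v \<in> verts (H i) then c i v else 0)" for v
  have "chromatic_number G \<le> card ({1..k} \<rightarrow>\<^sub>E {..<w})"
  proof (rule chromatic_number_le_card[OF G])
    show "f ` verts G \<subseteq> {1..k} \<rightarrow>\<^sub>E {..<w}"
      using c w by (auto simp: f_def proper_colouring_def Pi_iff)
    fix u v assume "{u, v} \<in> edges G"
    then obtain i where i: "i \<in> {1..k}" and e: "{u, v} \<in> edges (H i)"
      using cover by blast
    have "u \<in> verts (H i)" "v \<in> verts (H i)"
      using e H[OF i] by (auto simp: fin_graph_def nsets_def)
    then have "f u i \<noteq> f v i"
      using c[OF i] e i by (simp add: f_def proper_colouring_def)
    then show "f u \<noteq> f v" by auto
  qed (simp add: finite_PiE)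
  then show ?thesis by (simp add: card_PiE)
qed

lemma inj_on_extension:
  assumes fin: "finite A" "finite B" and card: "card A \<le> card B"
    and g: "S \<subseteq> A" "inj_on g S" "g ` S \<subseteq> B"
  obtains f where "inj_on f A" "f ` A \<subseteq> B" "\<And>x. x \<in> S \<Longrightarrow> f x = g x"
proof -
  have "finite S" using fin(1) g(1) by (rule rev_finite_subset)
  then have "card (A - S) \<le> card (B - g ` S)"
    using fin card g by (simp add: card_Diff_subset card_image)
  then obtain h where h: "h ` (A - S) \<subseteq> B - g ` S" "inj_on h (A - S)"
    using card_le_inj fin by (metis finite_Diff)
  define f where "f x = (if x \<in> S then g x else h x)" for x
  show thesis
  proof (rule that)
    have "g ` S \<inter> h ` (A - S) = {}" using h(1) by blast
    with g(2) h(2) have "inj_on f (S \<union> (A - S))"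
      unfolding f_def by (rule inj_on_disjoint_Un)
    moreover have "S \<union> (A - S) = A" using g(1) by blast
    ultimately show "inj_on f A" by (simp only:)
    have "f x \<in> B" if "x \<in> A" for x
    proof (cases "x \<in> S")
      case True
      then show ?thesis using g(3) by (simp add: f_def image_subset_iff)
    next
      case False
      then have "h x \<in> B" using h(1) that by blast
      then show ?thesis using False by (simp add: f_def)
    qed
    then show "f ` A \<subseteq> B" by blast
  qed (simp add: f_def)
qed

text \<open>
  Renaming the colours so that a maximum clique receives the constant words makes every letter
  injective on that clique. Without this, an individual letter need not use all its
  \<open>clique_number G\<close> values on a clique, and the graph it cuts out could have a chromatic number
  above its clique number.
\<close>

lemma word_colouring_exists:
  assumes G: "fin_graph G" and le: "chromatic_number G \<le> clique_number G ^ k"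
  obtains K and f :: "'a \<Rightarrow> nat \<Rightarrow> nat" where
    "K \<subseteq> verts G" "clique K (edges G)" "card K = clique_number G"
    "\<forall>v\<in>verts G. f v \<in> {1..k} \<rightarrow>\<^sub>E {..<clique_number G}"
    "\<forall>u v. {u, v} \<in> edges G \<longrightarrow> f u \<noteq> f v"
    "\<forall>i\<in>{1..k}. inj_on (\<lambda>v. f v i) K"
proof -
  let ?w = "clique_number G" and ?A = "{..<chromatic_number G}"
  let ?B = "{1..k} \<rightarrow>\<^sub>E {..<?w}"
  obtain K where K: "K \<subseteq> verts G" "clique K (edges G)" "card K = ?w"
    using maximum_clique_exists[OF G] .
  have finK: "finite K" using K(1) G by (auto simp: fin_graph_def intro: finite_subset)
  obtain c where c: "proper_colouring G (chromatic_number G) c"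
    using chromatic_number_le_iff[OF G] by blast
  have injc: "inj_on c K" by (rule proper_colouring_inj_on_clique[OF c K(1,2)])
  have cA: "c v \<in> ?A" if "v \<in> verts G" for v
    using c that by (auto simp: proper_colouring_def)
  have wc: "card (c ` K) = ?w" using injc K(3) by (simp add: card_image)
  obtain b where b: "bij_betw b (c ` K) {0..<?w}"
    using ex_bij_betw_finite_nat[of "c ` K"] finK wc by auto
  define g where "g x = (\<lambda>i\<in>{1..k}. b x)" for x
  have le_1: "?w \<le> 1" if "k = 0"
    using le that clique_number_le_chromatic_number[OF G] by simp
  have "inj_on g (c ` K)"
  proof (cases "k = 0")
    case True
    \<comment> \<open>All words are empty, but then there is at most one vertex in \<open>K\<close>.\<close>
    then have "card (c ` K) \<le> Suc 0" using le_1 wc by simp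
    moreover have "finite (c ` K)" using finK by simp
    ultimately have "\<forall>x\<in>c ` K. \<forall>y\<in>c ` K. x = y" using card_le_Suc0_iff_eq by blast
    then show ?thesis by (intro inj_onI) blast
  next
    case False
    then have "b x = b y" if "g x = g y" for x y
      using fun_cong[OF that, of 1] by (simp add: g_def)
    then show ?thesis using b by (metis bij_betw_imp_inj_on inj_onD inj_onI)
  qed
  moreover have "g ` c ` K \<subseteq> ?B"
    using b by (auto simp: g_def bij_betw_def)
  moreover have "c ` K \<subseteq> ?A" using cA K(1) by blast
  moreover have "finite ?A" "finite ?B" by (simp_all add: finite_PiE)
  moreover have "card ?A \<le> card ?B" using le by (simp add: card_PiE)
  ultimately obtain \<phi> where \<phi>: "inj_on \<phi> ?A" "\<phi> ` ?A \<subseteq> ?B" "\<And>x. x \<in> c ` K \<Longrightarrow> \<phi> x = g x"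
    using inj_on_extension[of ?A ?B "c ` K" g] by metis
  show thesis
  proof (rule that[OF K])
    show "\<forall>v\<in>verts G. \<phi> (c v) \<in> ?B"
      using \<phi>(2) cA by blast
    show "\<forall>u v. {u, v} \<in> edges G \<longrightarrow> \<phi> (c u) \<noteq> \<phi> (c v)"
    proof (intro allI impI)
      fix u v assume e: "{u, v} \<in> edges G"
      have uv: "u \<in> verts G" "v \<in> verts G"
        using e G by (auto simp: fin_graph_def nsets_def)
      then have "c u \<noteq> c v" using c e by (simp add: proper_colouring_def)
      then show "\<phi> (c u) \<noteq> \<phi> (c v)" using \<phi>(1) cA uv by (metis inj_onD)
    qed
    show "\<forall>i\<in>{1..k}. inj_on (\<lambda>v. \<phi> (c v) i) K"
    proof
      fix i assume i: "i \<in> {1..k}"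
      have "inj_on (b \<circ> c) K" using injc b by (auto simp: bij_betw_def intro: comp_inj_on)
      moreover have "\<phi> (c v) i = (b \<circ> c) v" if "v \<in> K" for v
        using \<phi>(3) that i by (simp add: g_def)
      ultimately show "inj_on (\<lambda>v. \<phi> (c v) i) K" by (simp cong: inj_on_cong)
    qed
  qed
qed

section \<open>Coverings by graphs with equal chromatic and clique number\<close>

text \<open>
  The \<open>i\<close>-th covering graph consists of the edges whose ends differ in the \<open>i\<close>-th letter of a word
  colouring. Its chromatic number is at most \<open>clique_number G\<close>, because the \<open>i\<close>-th letter colours
  it, and its clique number is at least that, because of the maximum clique on which all letters are
  injective.
\<close>

lemma has_covering_if_le_power:
  assumes G: "fin_graph G" and le: "chromatic_number G \<le> clique_number G ^ k"
  shows "has_covering chi_eq_omega G k"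
proof -
  let ?w = "clique_number G"
  obtain K f where K: "K \<subseteq> verts G" "clique K (edges G)" "card K = ?w"
    and f: "\<forall>v\<in>verts G. f v \<in> {1..k} \<rightarrow>\<^sub>E {..<?w}"
    and ne: "\<forall>u v. {u, v} \<in> edges G \<longrightarrow> f u \<noteq> f v"
    and inj: "\<forall>i\<in>{1..k}. inj_on (\<lambda>v. f v i) K"
    using word_colouring_exists[OF assms] .
  define H where "H i = (verts G, {e \<in> edges G. \<exists>u v. e = {u, v} \<and> f u i \<noteq> f v i})" for i
  have edge_H: "{u, v} \<in> edges (H i) \<longleftrightarrow> {u, v} \<in> edges G \<and> f u i \<noteq> f v i" for u v i
    unfolding H_def by (simp add: doubleton_eq_iff) metis
  have finH: "fin_graph (H i)" for i
    using G by (auto simp: H_def fin_graph_def)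
  have "chromatic_number (H i) = clique_number (H i)" if i: "i \<in> {1..k}" for i
  proof (rule antisym)
    have "proper_colouring (H i) ?w (\<lambda>v. f v i)"
      using f i edge_H[of _ _ i] by (auto simp: proper_colouring_def H_def PiE_iff)
    then have "chromatic_number (H i) \<le> ?w"
      using chromatic_number_le_iff[OF finH] by blast
    also have "clique K (edges (H i))"
      using K(2) inj i by (auto simp: clique_def edge_H inj_on_def)
    then have "?w \<le> clique_number (H i)"
      using card_clique_le_clique_number[OF finH, of K i] K(1,3) by (simp add: H_def)
    finally show "chromatic_number (H i) \<le> clique_number (H i)" .
  qed (rule clique_number_le_chromatic_number[OF finH])
  then have "\<forall>i\<in>{1..k}. fin_graph (H i) \<and> H i \<in> chi_eq_omega"
    using finH by (simp add: chi_eq_omega_def)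
  moreover have "edges G = (\<Union>i\<in>{1..k}. edges (H i))"
  proof (intro equalityI subsetI)
    fix e assume e: "e \<in> edges G"
    then have "card e = 2" "e \<subseteq> verts G"
      using G by (auto simp: fin_graph_def nsets_def)
    then obtain u v where uv: "e = {u, v}" "u \<in> verts G" "v \<in> verts G"
      by (auto simp: card_2_iff)
    then have "f u \<noteq> f v" using ne e by blast
    then have "\<exists>i\<in>{1..k}. f u i \<noteq> f v i"
      using PiE_ext f uv(2,3) by metis
    then show "e \<in> (\<Union>i\<in>{1..k}. edges (H i))" using edge_H e uv(1) by blast
  qed (auto simp: H_def)
  ultimately show ?thesis unfolding has_covering_def by blast
qed

lemma has_covering_iff:
  assumes G: "fin_graph G" "edges G \<noteq> {}"
  shows "has_covering chi_eq_omega G k \<longleftrightarrow> chromatic_number G \<le> clique_number G ^ k"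
proof
  assume "has_covering chi_eq_omega G k"
  then obtain H where H: "\<And>i. i \<in> {1..k} \<Longrightarrow> fin_graph (H i) \<and> H i \<in> chi_eq_omega"
    and cover: "edges G = (\<Union>i\<in>{1..k}. edges (H i))"
    unfolding has_covering_def by blast
  show "chromatic_number G \<le> clique_number G ^ k"
  proof (rule chromatic_number_le_power[OF G(1) _ _ cover])
    show "0 < clique_number G" using clique_number_ge_2_iff[OF G(1)] G(2) by linarith
    fix i assume i: "i \<in> {1..k}"
    then have "edges (H i) \<subseteq> edges G" using cover by blast
    with H[OF i] show "fin_graph (H i) \<and> chromatic_number (H i) \<le> clique_number G"
      using clique_number_mono_edges[OF G] by (simp add: chi_eq_omega_def)
  qed
qed (rule has_covering_if_le_power[OF G(1)])

section \<open>The cover number\<close>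

lemma int_Least_le_power_eq_ceiling:
  fixes m w :: nat
  assumes "0 < m" "2 \<le> w"
  shows "int (LEAST k. m \<le> w ^ k) = \<lceil>log 2 (real m) / log 2 (real w)\<rceil>"
proof -
  let ?x = "log 2 (real m) / log 2 (real w)"
  have x: "?x = log (real w) (real m)"
    using assms by (simp add: log_def)
  have iff: "m \<le> w ^ k \<longleftrightarrow> ?x \<le> real k" for k
  proof -
    have "?x \<le> real k \<longleftrightarrow> real m \<le> real w powr real k"
      unfolding x using assms by (intro log_le_iff) auto
    also have "real w powr real k = real (w ^ k)"
      using assms by (simp add: powr_realpow)
    finally show ?thesis by (simp only: of_nat_le_iff)
  qed
  have "0 \<le> ?x" using assms by simp
  then have "0 \<le> \<lceil>?x\<rceil>" by linarith
  have "(LEAST k. m \<le> w ^ k) = nat \<lceil>?x\<rceil>"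
    by (rule Least_equality) (simp_all add: iff real_nat_ceiling_ge nat_le_iff ceiling_le_iff)
  then show ?thesis using \<open>0 \<le> \<lceil>?x\<rceil>\<close> by simp
qed

theorem corollary4:
  fixes G :: "'a graph"
  assumes "fin_graph G"
  shows "int (cover_number chi_eq_omega G) =
    \<lceil>log 2 (real (chromatic_number G)) / log 2 (real (clique_number G))\<rceil>"
proof (cases "edges G = {}")
  case True
  then have "has_covering chi_eq_omega G 0" by (simp add: has_covering_def)
  then have "cover_number chi_eq_omega G = 0" by (simp add: cover_number_def)
  moreover have "clique_number G = 0 \<or> clique_number G = 1"
    using clique_number_ge_2_iff[OF assms] True by linarith
  ultimately show ?thesis by (auto simp: log_def)
next
  case False
  have w: "2 \<le> clique_number G" using clique_number_ge_2_iff[OF assms] False by simp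
  then have "0 < chromatic_number G"
    using clique_number_le_chromatic_number[OF assms] by linarith
  from int_Least_le_power_eq_ceiling[OF this w] show ?thesis
    by (simp add: cover_number_def has_covering_iff[OF assms False])
qed

end
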